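(* Let $(\mathcal Z,\mathcal H,R,\mathcal P_{\mathcal Z})$ be a statistical learning model. Assume that there exists a function $m_{\mathcal H,R,\mathcal P_{\mathcal Z}}:(0,1)^2\to\mathbb R_+$ such that for any $(\varepsilon,\delta)\in(0,1)^2$, any $n\ge m_{\mathcal H,R,\mathcal P_{\mathcal Z}}(\varepsilon,\delta)$ and any $\mu\in\mathcal P_{\mathcal Z}$, $$(\mu^n)_*\Big\{S\in\mathcal Z^n:\ \sup_{h\in\mathcal H}|\widehat R_S(h)-R_\mu(h)|\le\varepsilon\Big\}\ge 1-\delta .$$ Let $C=(c_1\ge c_2\ge\cdots)$, $c_i\ge0$, be any such sequence and let $A:\bigcup_{n\in\mathbb N^+}\mathcal Z^n\to\mathcal H$ be a $C$-ERM algorithm. Then for any $(\varepsilon,\delta)\in(0,1)^2$, any $m\ge m_{\mathcal H,R,\mathcal P_{\mathcal Z}}(\varepsilon,\delta)$ and any $\mu\in\mathcal P_{\mathcal Z}$, $$(\mu^m)_*\{S\in\mathcal Z^m:\ \mathcal E_{\mathcal H,R,\mu}(A(S))\le 2\varepsilon+c_m\}\ge 1-\delta .$$ Consequently, $A$ is a uniformly consistent algorithm if $\lim_{n\to\infty}c_n=0$.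
   Context: A statistical learning model $(\mathcal Z,\mathcal H,R,\mathcal P_{\mathcal Z})$ consists of a measurable space $\mathcal Z$, a decision space (set) $\mathcal H$, a set $\mathcal P_{\mathcal Z}\subset\mathcal P(\mathcal Z)$ of probability measures on $\mathcal Z$, and a loss function $R:\mathcal H\times(\mathcal P_{\mathcal Z}\cup\mathcal P_{emp}(\mathcal Z))\to\mathbb R\cup\{+\infty\}$ with $\inf_{h\in\mathcal H}R(h,\mu)\ne\pm\infty$ for all $\mu\in\mathcal P_{\mathcal Z}\cup\mathcal P_{emp}(\mathcal Z)$. Here $\mathcal P_{emp}(\mathcal Z)$ is the set of empirical measures $\mu_S=\frac1n\sum_{i=1}^n\delta_{z_i}$, $S=(z_1,\dots,z_n)\in\mathcal Z^n$. Write $R_\mu(h)=R(h,\mu)$ and $\widehat R_S(h)=R_{\mu_S}(h)$. The estimation error is $\mathcal E_{\mathcal H,R,\mu}(h)=R_\mu(h)-\inf_{h'\in\mathcal H}R_\mu(h')$. A learning algorithm is a map $A:\bigcup_{n\ge1}\mathcal Z^n\to\mathcal H$ (no measurability required). For a sequence $C=(c_1\ge c_2\ge\cdots)$, $c_i\ge0$, $A$ is a $C$-empirical risk minimizing ($C$-ERM) algorithm if $\widehat R_S(A(S))-\inf_{h\in\mathcal H}\widehat R_S(h)\le c_n$ for every $n$ and every $S\in\mathcal Z^n$. $\mu^n$ is the product measure on $\mathcal Z^n$ and, for a measure $\nu$, $\nu_*(S)=\sup\{\nu(B):B\subset S,\ B\text{ measurable}\}$ is the inner measure of an arbitrary set $S$.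 $A$ is uniformly consistent if for any $(\varepsilon,\delta)\in(0,1)^2$ there is a number $m_A(\varepsilon,\delta)$ such that $(\mu^m)_*\{S\in\mathcal Z^m:\mathcal E_{\mathcal H,R,\mu}(A(S))\le\varepsilon\}\ge1-\delta$ for all $m\ge m_A(\varepsilon,\delta)$ and all $\mu\in\mathcal P_{\mathcal Z}$. *)

theory Defs
  imports "HOL-Probability.Probability"
begin

text \<open>
  A measurable space is represented by a measure \<open>M\<close> of which only \<open>space M\<close> and \<open>sets M\<close>
  matter. A sample of size \<open>n\<close> is an element of \<open>space (\<Pi>\<^sub>M i\<in>{..<n}. M)\<close>, i.e. an extensional
  function on \<open>{..<n}\<close>; the entries \<open>z\<^sub>1, \<dots>, z\<^sub>n\<close> are \<open>S 0, \<dots>, S (n - 1)\<close>.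
\<close>

abbreviation samples :: "'z measure \<Rightarrow> nat \<Rightarrow> (nat \<Rightarrow> 'z) set" where
  "samples M n \<equiv> space (\<Pi>\<^sub>M i\<in>{..<n}. M)"

abbreviation power_measure :: "'z measure \<Rightarrow> nat \<Rightarrow> (nat \<Rightarrow> 'z) measure" where
  "power_measure \<mu> n \<equiv> (\<Pi>\<^sub>M i\<in>{..<n}. \<mu>)"

text \<open>\<open>return M z\<close> is the Dirac measure at \<open>z\<close>.\<close>

definition empirical_measure :: "'z measure \<Rightarrow> nat \<Rightarrow> (nat \<Rightarrow> 'z) \<Rightarrow> 'z measure" where
  "empirical_measure M n S =
     measure_of (space M) (sets M)
       (\<lambda>B. ennreal (1 / real n) * (\<Sum>i<n. emeasure (return M (S i)) B))"

lemma sets_empirical_measure [simp]: "sets (empirical_measure M n S) = sets M"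
  and space_empirical_measure [simp]: "space (empirical_measure M n S) = space M"
  by (simp_all add: empirical_measure_def)

lemma emeasure_empirical_measure:
  assumes "B \<in> sets M"
  shows "emeasure (empirical_measure M n S) B =
           ennreal (1 / real n) * (\<Sum>i<n. emeasure (return M (S i)) B)"
  unfolding empirical_measure_def
proof (rule emeasure_measure_of_sigma)
  show "sigma_algebra (space M) (sets M)"
    by (rule sets.sigma_algebra_axioms)
  show "positive (sets M) (\<lambda>B. ennreal (1 / real n) * (\<Sum>i<n. emeasure (return M (S i)) B))"
    by (simp add: positive_def)
  show "countably_additive (sets M)
          (\<lambda>B. ennreal (1 / real n) * (\<Sum>i<n. emeasure (return M (S i)) B))"
  proof (rule countably_additiveI)
    fix B :: "nat \<Rightarrow> 'a set"
    assume B: "range B \<subseteq> sets M" "disjoint_family B"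
    have "(\<Sum>k. emeasure (return M (S i)) (B k)) = emeasure (return M (S i)) (\<Union>k. B k)" for i
      using B by (intro suminf_emeasure) auto
    then show "(\<Sum>k. ennreal (1 / real n) * (\<Sum>i<n. emeasure (return M (S i)) (B k))) =
               ennreal (1 / real n) * (\<Sum>i<n. emeasure (return M (S i)) (\<Union>k. B k))"
      by (simp add: ennreal_suminf_cmult suminf_sum)
  qed
qed (fact assms)

lemma prob_space_empirical_measure:
  assumes "n \<ge> 1" "S \<in> samples M n"
  shows "prob_space (empirical_measure M n S)"
proof
  have "S i \<in> space M" if "i < n" for i
    using assms(2) that by (auto simp: space_PiM)
  then have "(\<Sum>i<n. emeasure (return M (S i)) (space M)) = (\<Sum>i<n. 1)"
    by (intro sum.cong) auto
  also have "\<dots> = ennreal (real n)"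
    by (simp add: ennreal_of_nat_eq_real_of_nat)
  finally show "emeasure (empirical_measure M n S) (space (empirical_measure M n S)) = 1"
    using assms(1) by (simp add: emeasure_empirical_measure flip: ennreal_mult)
qed

definition empirical_measures :: "'z measure \<Rightarrow> 'z measure set" where
  "empirical_measures M = {empirical_measure M n S | n S. n \<ge> 1 \<and> S \<in> samples M n}"

text \<open>
  \<open>space (prob_algebra M)\<close> is the set of all probability measures on \<open>M\<close>. The loss takes values
  in \<open>\<real> \<union> {+\<infinity>}\<close>.
\<close>

locale statistical_learning_model =
  fixes M :: "'z measure"
    and H :: "'h set"
    and R :: "'h \<Rightarrow> 'z measure \<Rightarrow> ereal"
    and P :: "'z measure set"
  assumes P_prob: "P \<subseteq> space (prob_algebra M)"
    and loss_not_MInf: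
      "\<And>h \<mu>. h \<in> H \<Longrightarrow> \<mu> \<in> P \<union> empirical_measures M \<Longrightarrow> R h \<mu> \<noteq> -\<infinity>"
    and Inf_loss_finite:
      "\<And>\<mu>. \<mu> \<in> P \<union> empirical_measures M \<Longrightarrow>
         (INF h\<in>H. R h \<mu>) \<noteq> \<infinity> \<and> (INF h\<in>H. R h \<mu>) \<noteq> -\<infinity>"

definition empirical_loss ::
    "'z measure \<Rightarrow> ('h \<Rightarrow> 'z measure \<Rightarrow> ereal) \<Rightarrow> nat \<Rightarrow> (nat \<Rightarrow> 'z) \<Rightarrow> 'h \<Rightarrow> ereal" where
  "empirical_loss M R n S h = R h (empirical_measure M n S)"

definition estimation_error ::
    "'h set \<Rightarrow> ('h \<Rightarrow> 'z measure \<Rightarrow> ereal) \<Rightarrow> 'z measure \<Rightarrow> 'h \<Rightarrow> ereal" where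
  "estimation_error H R \<mu> h = R h \<mu> - (INF h'\<in>H. R h' \<mu>)"

text \<open>
  The distance \<open>\<bar>a - b\<bar>\<close> of two losses in \<open>\<real> \<union> {+\<infinity>}\<close>. The expression \<open>\<infinity> - \<infinity>\<close> is read as \<open>0\<close>
  here, whereas \<open>\<infinity> - \<infinity> = \<infinity>\<close> in type \<open>ereal\<close>. Reading it as \<open>0\<close> makes uniform closeness of
  losses the weaker assumption of the two.
\<close>

definition loss_dist :: "ereal \<Rightarrow> ereal \<Rightarrow> ereal" where
  "loss_dist a b = (if a = b then 0 else \<bar>a - b\<bar>)"

text \<open>
  A learning algorithm is a map on the disjoint union of the sets of samples of size \<open>n \<ge> 1\<close>.
  The size is an explicit argument, since extensional functions with different domains may
  coincide.
\<close>

definition learning_algorithm ::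
    "'z measure \<Rightarrow> 'h set \<Rightarrow> (nat \<Rightarrow> (nat \<Rightarrow> 'z) \<Rightarrow> 'h) \<Rightarrow> bool" where
  "learning_algorithm M H A \<longleftrightarrow> (\<forall>n\<ge>1. \<forall>S\<in>samples M n. A n S \<in> H)"

text \<open>Sequences are indexed from \<open>1\<close>; the value \<open>c 0\<close> is irrelevant.\<close>

definition C_ERM_algorithm ::
    "'z measure \<Rightarrow> 'h set \<Rightarrow> ('h \<Rightarrow> 'z measure \<Rightarrow> ereal) \<Rightarrow> (nat \<Rightarrow> real) \<Rightarrow>
     (nat \<Rightarrow> (nat \<Rightarrow> 'z) \<Rightarrow> 'h) \<Rightarrow> bool" where
  "C_ERM_algorithm M H R c A \<longleftrightarrow>
     learning_algorithm M H A \<and>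
     (\<forall>n\<ge>1. \<forall>S\<in>samples M n.
        empirical_loss M R n S (A n S) - (INF h\<in>H. empirical_loss M R n S h) \<le> ereal (c n))"

definition inner_measure :: "'a measure \<Rightarrow> 'a set \<Rightarrow> ennreal" where
  "inner_measure \<nu> S = (SUP B\<in>{B \<in> sets \<nu>. B \<subseteq> S}. emeasure \<nu> B)"

definition uniformly_consistent ::
    "'z measure \<Rightarrow> 'h set \<Rightarrow> ('h \<Rightarrow> 'z measure \<Rightarrow> ereal) \<Rightarrow> 'z measure set \<Rightarrow>
     (nat \<Rightarrow> (nat \<Rightarrow> 'z) \<Rightarrow> 'h) \<Rightarrow> bool" where
  "uniformly_consistent M H R P A \<longleftrightarrow>
     (\<forall>\<epsilon>\<in>{0<..<1::real}. \<forall>\<delta>\<in>{0<..<1::real}. \<exists>m\<^sub>A::real.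
        \<forall>m\<ge>1. real m \<ge> m\<^sub>A \<longrightarrow> (\<forall>\<mu>\<in>P.
          inner_measure (power_measure \<mu> m)
            {S \<in> samples M m. estimation_error H R \<mu> (A m S) \<le> ereal \<epsilon>} \<ge> ennreal (1 - \<delta>)))"

end

theory Submission
  imports Defs
begin

text \<open>The argument is deterministic once a sample \<open>S\<close> is fixed. If empirical and
  true losses differ by at most \<epsilon> on all of \<open>H\<close>, then the empirical infimum
  exceeds the true one by at most \<epsilon>, and the true loss of \<open>A n S\<close> exceeds its
  empirical loss by at most \<epsilon>; the ERM gap \<open>c n\<close> separates the two, so the
  total is 2\<epsilon> + \<open>c n\<close> (\<open>minus_INF_le_of_loss_dist_le\<close>,
  \<open>estimation_error_C_ERM_le\<close>). Hence the event of uniform closeness lies inside the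
  event of small estimation error, and monotonicity of inner measure carries the probability bound
  over without any measurability. Consistency follows by running this at accuracy \<epsilon>/3 once
  \<open>c n\<close> is below \<epsilon>/3.\<close>

lemma loss_dist_nonneg: "0 \<le> loss_dist a b"
  by (simp add: loss_dist_def)

lemma loss_dist_commute: "loss_dist a b = loss_dist b a"
  by (cases a; cases b) (auto simp: loss_dist_def abs_minus_commute)

text \<open>A finite bound rules out that exactly one loss is infinite, and if both are \<infinity>
  the inequality is trivial; so the convention \<infinity> - \<infinity> = 0 does no harm.\<close>

lemma loss_dist_leD:
  assumes "loss_dist a b \<le> ereal e"
  shows "a \<le> b + ereal e"
proof -
  have "0 \<le> ereal e"
    using loss_dist_nonneg assms by (rule order_trans)
  then show ?thesis
    using assms by (cases a; cases b) (auto simp: loss_dist_def split: if_splits)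
qed

text \<open>Here \<open>f\<close> plays the empirical loss and \<open>g\<close> the true one.
  Closeness is paid for twice, once for the infima and once at \<open>h0\<close>, whence
  \<open>2 * e\<close>.\<close>

lemma minus_INF_le_of_loss_dist_le:
  fixes f g :: "'h \<Rightarrow> ereal"
  assumes close: "\<And>h. h \<in> H \<Longrightarrow> loss_dist (f h) (g h) \<le> ereal e"
    and h0: "h0 \<in> H" "f h0 - (INF h\<in>H. f h) \<le> ereal c"
    and f: "\<bar>INF h\<in>H. f h\<bar> \<noteq> \<infinity>" and g: "\<bar>INF h\<in>H. g h\<bar> \<noteq> \<infinity>"
  shows "g h0 - (INF h\<in>H. g h) \<le> ereal (2 * e + c)"
proof -
  obtain a b where a: "(INF h\<in>H. f h) = ereal a" and b: "(INF h\<in>H. g h) = ereal b"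
    using f g by (metis ereal_real)
  \<comment> \<open>The infimum of \<open>g\<close> need not be attained, so a lower bound for every
    \<open>g h\<close> replaces the choice of a minimizer.\<close>
  have "ereal a - ereal e \<le> (INF h\<in>H. g h)"
  proof (rule INF_greatest)
    fix h assume h: "h \<in> H"
    have "ereal a \<le> f h"
      using h unfolding a[symmetric] by (rule INF_lower)
    also have "f h \<le> g h + ereal e"
      using close[OF h] by (rule loss_dist_leD)
    finally show "ereal a - ereal e \<le> g h"
      by (cases "g h") auto
  qed
  then have ab: "a - e \<le> b"
    by (simp add: b)
  \<comment> \<open>Closeness is now read in the opposite direction. Since \<open>f h0\<close>
    exceeds the real number \<open>a\<close> by at most \<open>c\<close>, it is not \<infinity>, and
    so neither is \<open>g h0\<close>.\<close>
  have "g h0 \<le> f h0 + ereal e"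
    using close[OF h0(1)] by (intro loss_dist_leD) (simp add: loss_dist_commute)
  then show ?thesis
    using h0(2) ab unfolding a b by (cases "g h0"; cases "f h0") auto
qed

lemma inner_measure_mono: "A \<subseteq> B \<Longrightarrow> inner_measure \<nu> A \<le> inner_measure \<nu> B"
  unfolding inner_measure_def by (intro SUP_subset_mono) auto

lemma (in statistical_learning_model) estimation_error_C_ERM_le:
  assumes A: "C_ERM_algorithm M H R c A" and "n \<ge> 1" "S \<in> samples M n" "\<mu> \<in> P"
    and close: "(SUP h\<in>H. loss_dist (empirical_loss M R n S h) (R h \<mu>)) \<le> ereal \<epsilon>"
  shows "estimation_error H R \<mu> (A n S) \<le> ereal (2 * \<epsilon> + c n)"
  unfolding estimation_error_def
proof (rule minus_INF_le_of_loss_dist_le)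
  show "loss_dist (empirical_loss M R n S h) (R h \<mu>) \<le> ereal \<epsilon>" if "h \<in> H" for h
    using SUP_upper[OF that] close by (rule order_trans)
  show "A n S \<in> H"
    "empirical_loss M R n S (A n S) - (INF h\<in>H. empirical_loss M R n S h) \<le> ereal (c n)"
    using assms by (auto simp: C_ERM_algorithm_def learning_algorithm_def)
  \<comment> \<open>Uses \<open>n \<ge> 1\<close>; it makes the finiteness of infima in the model
    available for the empirical loss.\<close>
  have "empirical_measure M n S \<in> P \<union> empirical_measures M"
    using assms by (auto simp: empirical_measures_def)
  from Inf_loss_finite[OF this]
  show "\<bar>INF h\<in>H. empirical_loss M R n S h\<bar> \<noteq> \<infinity>"
    by (auto simp: empirical_loss_def)
  show "\<bar>INF h\<in>H. R h \<mu>\<bar> \<noteq> \<infinity>"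
    using Inf_loss_finite[of \<mu>] \<open>\<mu> \<in> P\<close> by auto
qed

theorem theorem3p13:
  fixes M :: "'z measure"
    and H :: "'h set"
    and R :: "'h \<Rightarrow> 'z measure \<Rightarrow> ereal"
    and P :: "'z measure set"
    and m_H :: "real \<Rightarrow> real \<Rightarrow> real"
    and c :: "nat \<Rightarrow> real"
    and A :: "nat \<Rightarrow> (nat \<Rightarrow> 'z) \<Rightarrow> 'h"
  assumes "statistical_learning_model M H R P"
    and "\<And>\<epsilon> \<delta>. \<epsilon> \<in> {0<..<1} \<Longrightarrow> \<delta> \<in> {0<..<1} \<Longrightarrow> m_H \<epsilon> \<delta> \<ge> 0"
    and "\<And>\<epsilon> \<delta> n \<mu>. \<epsilon> \<in> {0<..<1} \<Longrightarrow> \<delta> \<in> {0<..<1} \<Longrightarrow> n \<ge> 1 \<Longrightarrow> real n \<ge> m_H \<epsilon> \<delta> \<Longrightarrow> \<mu> \<in> P \<Longrightarrow>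
           inner_measure (power_measure \<mu> n)
             {S \<in> samples M n. (SUP h\<in>H. loss_dist (empirical_loss M R n S h) (R h \<mu>)) \<le> ereal \<epsilon>}
           \<ge> ennreal (1 - \<delta>)"
    and "\<And>i. i \<ge> 1 \<Longrightarrow> c i \<ge> 0"
    and "\<And>i j. 1 \<le> i \<Longrightarrow> i \<le> j \<Longrightarrow> c j \<le> c i"
    and "C_ERM_algorithm M H R c A"
  shows "(\<forall>\<epsilon>\<in>{0<..<1}. \<forall>\<delta>\<in>{0<..<1}. \<forall>m\<ge>1. real m \<ge> m_H \<epsilon> \<delta> \<longrightarrow> (\<forall>\<mu>\<in>P.
            inner_measure (power_measure \<mu> m)
              {S \<in> samples M m. estimation_error H R \<mu> (A m S) \<le> ereal (2 * \<epsilon> + c m)}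
            \<ge> ennreal (1 - \<delta>)))
       \<and> (c \<longlonglongrightarrow> 0 \<longrightarrow> uniformly_consistent M H R P A)"
proof -
  interpret statistical_learning_model M H R P by fact
  have bound: "ennreal (1 - \<delta>) \<le> inner_measure (power_measure \<mu> m)
      {S \<in> samples M m. estimation_error H R \<mu> (A m S) \<le> ereal (2 * \<epsilon> + c m)}"
    if "\<epsilon> \<in> {0<..<1}" "\<delta> \<in> {0<..<1}" "m \<ge> 1" "real m \<ge> m_H \<epsilon> \<delta>" "\<mu> \<in> P" for \<epsilon> \<delta> m \<mu>
    \<comment> \<open>The pointwise estimate is exactly the inclusion of the closeness event in the
      error event.\<close>
    using assms(3)[OF that] that estimation_error_C_ERM_le[OF assms(6)]
    by (elim order_trans) (intro inner_measure_mono, auto)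
  have "uniformly_consistent M H R P A" if lim: "c \<longlonglongrightarrow> 0"
    unfolding uniformly_consistent_def
  proof (intro ballI)
    fix \<epsilon> \<delta> :: real assume \<epsilon>: "\<epsilon> \<in> {0<..<1}" and \<delta>: "\<delta> \<in> {0<..<1}"
    have "eventually (\<lambda>n. c n < \<epsilon> / 3) sequentially"
      using lim \<epsilon> by (intro order_tendstoD) auto
    then obtain N where N: "c n < \<epsilon> / 3" if "n \<ge> N" for n
      by (auto simp: eventually_sequentially)
    show "\<exists>m\<^sub>A::real. \<forall>m\<ge>1. real m \<ge> m\<^sub>A \<longrightarrow> (\<forall>\<mu>\<in>P.
        inner_measure (power_measure \<mu> m)
          {S \<in> samples M m. estimation_error H R \<mu> (A m S) \<le> ereal \<epsilon>} \<ge> ennreal (1 - \<delta>))"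
    \<comment> \<open>Neither \<open>N\<close> nor \<open>m_H\<close> depends on \<mu>, so the
      threshold is uniform over \<open>P\<close>. Past it, the error is at most 2\<epsilon>/3 +
      \<epsilon>/3.\<close>
    proof (intro exI[of _ "max (real N) (m_H (\<epsilon> / 3) \<delta>)"] allI impI ballI)
      fix m :: nat and \<mu>
      assume m: "m \<ge> 1" "real m \<ge> max (real N) (m_H (\<epsilon> / 3) \<delta>)" and \<mu>: "\<mu> \<in> P"
      have "ereal (2 * (\<epsilon> / 3) + c m) \<le> ereal \<epsilon>"
        using N[of m] m by simp
      then have "{S \<in> samples M m. estimation_error H R \<mu> (A m S) \<le> ereal (2 * (\<epsilon> / 3) + c m)}
          \<subseteq> {S \<in> samples M m. estimation_error H R \<mu> (A m S) \<le> ereal \<epsilon>}"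
        by (blast intro: order_trans)
      moreover have "ennreal (1 - \<delta>) \<le> inner_measure (power_measure \<mu> m)
          {S \<in> samples M m. estimation_error H R \<mu> (A m S) \<le> ereal (2 * (\<epsilon> / 3) + c m)}"
        using \<epsilon> \<delta> m \<mu> by (intro bound) auto
      ultimately show "ennreal (1 - \<delta>) \<le> inner_measure (power_measure \<mu> m)
          {S \<in> samples M m. estimation_error H R \<mu> (A m S) \<le> ereal \<epsilon>}"
        by (blast intro: order_trans inner_measure_mono)
    qed
  qed
  with bound show ?thesis by blast
qed

end
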